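(* Let $\rho_1,\rho_2:\mathbb{R}\to\mathbb{R}^+$ each satisfy: (P1) $\rho(0)=0$ and $\rho$ is continuous at $0$; (P2) $\rho(-u)=\rho(u)$ for $u>0$; (P3) $\rho$ is nondecreasing on $u>0$; (P4) $\sup_u\rho(u)<+\infty$. Assume $\rho_2\le\rho_1$ and $\sup\rho_2=\sup\rho_1=a>0$, and let $0<b<a$. Let $\mathbf{Z}_n=(\mathbf{z}_1,\dots,\mathbf{z}_n)$, $\mathbf{z}_i=(y_i^*,\mathbf{x}_i,\delta_i)\in\mathbb{R}\times\mathbb{R}^p\times\{0,1\}$, be a censored regression sample such that $\{\mathbf{x}_1,\dots,\mathbf{x}_n\}$ has rank $p$. Put $$q=\max_{\|\theta\|=1}\#\{i:\theta'\mathbf{x}_i=0\},\qquad m=\#\{i:\delta_i=0\},$$ $$k_0=\min\left(n\left(1-\frac{b}{a}\right)-q-m,\; n\frac{b}{a}-m\right).$$ Let $\hat{\boldsymbol\beta}_n$ be the MM-estimator for censored regression (defined in the context) based on $\rho_1,\rho_2$ and $b$. Then $$\epsilon_n^*(\hat{\boldsymbol\beta}_n,\mathbf{Z}_n)\ \ge\ \frac{k_0}{n}.$$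
   Context: Samples. A censored regression sample of size $n$ is a list of $\mathbf{z}_i=(y_i^*,\mathbf{x}_i,\delta_i)$, $i=1,\dots,n$, with $y_i^*\in\mathbb{R}$, $\mathbf{x}_i\in\mathbb{R}^p$, and $\delta_i=1$ if the $i$th response is uncensored, $\delta_i=0$ if it is (right-)censored. Kaplan–Meier weights. For $\boldsymbol\beta\in\mathbb{R}^p$ let $r_i^*(\boldsymbol\beta)=y_i^*-\boldsymbol\beta'\mathbf{x}_i$. Let $F^*_{n\boldsymbol\beta}$ be the Kaplan–Meier (product-limit) estimator based on the pairs $(r_i^*(\boldsymbol\beta),\delta_i)$, where observations whose residual equals the largest residual are treated as uncensored (i.e. their $\delta_i$ is replaced by 1), so that $F^*_{n\boldsymbol\beta}$ is a probability distribution: $1-F^*_{n\boldsymbol\beta}(t)=\prod_{v\le t}(1-d(v)/N(v))$, the product being over the distinct uncensored residual values $v$, with $d(v)=\#\{j:\delta_j=1,r_j^*(\boldsymbol\beta)=v\}$ and $N(v)=\#\{j:r_j^*(\boldsymbol\beta)\ge v\}$. For $\delta_j=1$ let $\pi_j$ be the jump of $F^*_{n\boldsymbol\beta}$ at $r_j^*(\boldsymbol\beta)$ divided by $d(r_j^*(\boldsymbol\beta))$. For $\delta_i=0$ let $M_i=\{j:r_j^*(\boldsymbol\beta)>r_i^*(\boldsymbol\beta),\ \delta_j=1\}$. Set $$\pi_{\boldsymbol\beta,ij}=\begin{cases}\pi_j/\big(n\sum_{k\in M_i}\pi_k\big), & \delta_i=0,\ j\in M_i,\\ 1/n, & \delta_i=1,\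 i=j,\\ 0,&\text{otherwise.}\end{cases}$$ $H^*_{n\boldsymbol\beta}$ is the discrete distribution on $\mathbb{R}\times\mathbb{R}^p$ that puts mass $\pi_{\boldsymbol\beta,ij}$ at $(r_j^*(\boldsymbol\beta),\mathbf{x}_i)$; thus $E_{H^*_{n\boldsymbol\beta}}[g(u,\mathbf{x})]=\sum_{i,j}\pi_{\boldsymbol\beta,ij}\,g(r_j^*(\boldsymbol\beta),\mathbf{x}_i)$. Initial S-estimator. For $\boldsymbol\beta,\boldsymbol\gamma\in\mathbb{R}^p$ let $$S_n(\boldsymbol\beta,\boldsymbol\gamma)=\inf\{s>0:E_{H^*_{n\boldsymbol\beta}}[\rho_1((u-\boldsymbol\gamma'\mathbf{x})/s)]<b\},$$ and let $\hat{\boldsymbol\gamma}_n(\boldsymbol\beta)$ be a minimizer of $\boldsymbol\gamma\mapsto S_n(\boldsymbol\beta,\boldsymbol\gamma)$ over $\mathbb{R}^p$. The S-regression estimator $\tilde{\boldsymbol\beta}_n$ is a vector such that $\hat{\boldsymbol\gamma}_n(\tilde{\boldsymbol\beta}_n)=\mathbf{0}$. The residual scale is $s_n=S_n(\tilde{\boldsymbol\beta}_n,\hat{\boldsymbol\gamma}_n(\tilde{\boldsymbol\beta}_n))=S_n(\tilde{\boldsymbol\beta}_n,\mathbf{0})$, required to satisfy $s_n>0$ and its defining equation $E_{H^*_{n\tilde{\boldsymbol\beta}_n}}[\rho_1(u/s_n)]=b$. MM-estimator. Let $R(\boldsymbol\gamma)=E_{H^*_{n\tilde{\boldsymbol\beta}_n}}[\rho_2((u-\boldsymbol\gamma'\mathbf{x})/s_n)]$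 and let $\tilde{\boldsymbol\gamma}_n$ be a local minimum of $R$ with $R(\tilde{\boldsymbol\gamma}_n)\le R(\mathbf{0})$. The MM-estimator is $\hat{\boldsymbol\beta}_n=\tilde{\boldsymbol\beta}_n+\tilde{\boldsymbol\gamma}_n$. The estimator is said to be defined at a sample if all the objects above exist; choices among several candidates are arbitrary. It is assumed to be defined at $\mathbf{Z}_n$. Breakdown point. For an estimator $\mathbf{T}_n$, $$\epsilon_n^*(\mathbf{T}_n,\mathbf{Z}_n)=\min_{1\le k\le n}\{k/n:\sup\|\mathbf{T}_n(\mathbf{Z}^*_{k,n})-\mathbf{T}_n(\mathbf{Z}_n)\|=\infty\},$$ the supremum being over all samples $\mathbf{Z}^*_{k,n}$ obtained by replacing $k$ observations of $\mathbf{Z}_n$ by arbitrary values in $\mathbb{R}\times\mathbb{R}^p\times\{0,1\}$ at which $\mathbf{T}_n$ is defined; the minimum of the empty set is $+\infty$, and $\|\cdot\|$ is the Euclidean norm. *)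

theory Defs
  imports "HOL-Analysis.Analysis"
begin

definition rho_function :: "(real \<Rightarrow> real) \<Rightarrow> bool" where
  "rho_function \<rho> \<longleftrightarrow>
     (\<forall>u. 0 \<le> \<rho> u) \<and>
     \<rho> 0 = 0 \<and> isCont \<rho> 0 \<and>
     (\<forall>u>0. \<rho> (- u) = \<rho> u) \<and>
     mono_on {0<..} \<rho> \<and>
     bdd_above (range \<rho>)"

text \<open>An observation is \<open>(y\<^sup>*, x, \<delta>)\<close>; \<open>\<delta>\<close> is \<open>True\<close> iff the response is uncensored.\<close>

type_synonym 'p observation = "real \<times> (real^'p) \<times> bool"
type_synonym 'p sample = "'p observation list"

definition resp :: "'p sample \<Rightarrow> nat \<Rightarrow> real" where
  "resp Z i = fst (Z ! i)"

definition covar :: "'p sample \<Rightarrow> nat \<Rightarrow> real^'p" where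
  "covar Z i = fst (snd (Z ! i))"

definition uncensored :: "'p sample \<Rightarrow> nat \<Rightarrow> bool" where
  "uncensored Z i = snd (snd (Z ! i))"

definition resid :: "'p::finite sample \<Rightarrow> real^'p \<Rightarrow> nat \<Rightarrow> real" where
  "resid Z \<beta> i = resp Z i - \<beta> \<bullet> covar Z i"

text \<open>The status after treating the observations with the largest residual as uncensored. This
  modified status is the one used in the product-limit estimator and in all the weights; it depends
  on \<open>\<beta>\<close>.\<close>

definition km_uncensored :: "'p::finite sample \<Rightarrow> real^'p \<Rightarrow> nat \<Rightarrow> bool" where
  "km_uncensored Z \<beta> i \<longleftrightarrow>
     uncensored Z i \<or> resid Z \<beta> i = (MAX j\<in>{..<length Z}. resid Z \<beta> j)"

definition km_deaths :: "'p::finite sample \<Rightarrow> real^'p \<Rightarrow> real \<Rightarrow> nat" where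
  "km_deaths Z \<beta> v = card {j. j < length Z \<and> km_uncensored Z \<beta> j \<and> resid Z \<beta> j = v}"

definition km_at_risk :: "'p::finite sample \<Rightarrow> real^'p \<Rightarrow> real \<Rightarrow> nat" where
  "km_at_risk Z \<beta> v = card {j. j < length Z \<and> resid Z \<beta> j \<ge> v}"

definition km_values :: "'p::finite sample \<Rightarrow> real^'p \<Rightarrow> real set" where
  "km_values Z \<beta> = {resid Z \<beta> j | j. j < length Z \<and> km_uncensored Z \<beta> j}"

definition km_cdf :: "'p::finite sample \<Rightarrow> real^'p \<Rightarrow> real \<Rightarrow> real" where
  "km_cdf Z \<beta> t =
     1 - (\<Prod>v\<in>{v \<in> km_values Z \<beta>. v \<le> t}. 1 - real (km_deaths Z \<beta> v) / real (km_at_risk Z \<beta> v))"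

definition jump :: "(real \<Rightarrow> real) \<Rightarrow> real \<Rightarrow> real" where
  "jump F t = F t - Lim (at_left t) F"

definition km_mass :: "'p::finite sample \<Rightarrow> real^'p \<Rightarrow> nat \<Rightarrow> real" where
  "km_mass Z \<beta> j =
     jump (km_cdf Z \<beta>) (resid Z \<beta> j) / real (km_deaths Z \<beta> (resid Z \<beta> j))"

definition later_uncensored :: "'p::finite sample \<Rightarrow> real^'p \<Rightarrow> nat \<Rightarrow> nat set" where
  "later_uncensored Z \<beta> i =
     {j. j < length Z \<and> resid Z \<beta> j > resid Z \<beta> i \<and> km_uncensored Z \<beta> j}"

definition km_weight :: "'p::finite sample \<Rightarrow> real^'p \<Rightarrow> nat \<Rightarrow> nat \<Rightarrow> real" where
  "km_weight Z \<beta> i j =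
     (if \<not> km_uncensored Z \<beta> i \<and> j \<in> later_uncensored Z \<beta> i then
        km_mass Z \<beta> j / (real (length Z) * (\<Sum>k\<in>later_uncensored Z \<beta> i. km_mass Z \<beta> k))
      else if km_uncensored Z \<beta> i \<and> i = j then 1 / real (length Z)
      else 0)"

text \<open>Expectation of \<open>g (u, x)\<close> under the discrete distribution with mass \<open>km_weight Z \<beta> i j\<close> at
  \<open>(resid Z \<beta> j, covar Z i)\<close>.\<close>

definition km_expectation ::
  "'p::finite sample \<Rightarrow> real^'p \<Rightarrow> (real \<Rightarrow> real^'p \<Rightarrow> real) \<Rightarrow> real" where
  "km_expectation Z \<beta> g =
     (\<Sum>i<length Z. \<Sum>j<length Z. km_weight Z \<beta> i j * g (resid Z \<beta> j) (covar Z i))"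

definition S_scale ::
  "(real \<Rightarrow> real) \<Rightarrow> real \<Rightarrow> 'p::finite sample \<Rightarrow> real^'p \<Rightarrow> real^'p \<Rightarrow> real" where
  "S_scale \<rho> b Z \<beta> \<gamma> = Inf {s. s > 0 \<and> km_expectation Z \<beta> (\<lambda>u x. \<rho> ((u - \<gamma> \<bullet> x) / s)) < b}"

definition is_gamma_hat ::
  "(real \<Rightarrow> real) \<Rightarrow> real \<Rightarrow> 'p::finite sample \<Rightarrow> real^'p \<Rightarrow> real^'p \<Rightarrow> bool" where
  "is_gamma_hat \<rho> b Z \<beta> \<gamma> \<longleftrightarrow> is_arg_min (S_scale \<rho> b Z \<beta>) (\<lambda>_. True) \<gamma>"

text \<open>Minimizers need not exist or be unique. Existence is required only at \<open>\<beta>\<close> itself, not for the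
  other values of the regression parameter.\<close>

definition is_S_regression ::
  "(real \<Rightarrow> real) \<Rightarrow> real \<Rightarrow> 'p::finite sample \<Rightarrow> real^'p \<Rightarrow> bool" where
  "is_S_regression \<rho> b Z \<beta> \<longleftrightarrow> is_gamma_hat \<rho> b Z \<beta> 0"

definition MM_objective ::
  "(real \<Rightarrow> real) \<Rightarrow> 'p::finite sample \<Rightarrow> real^'p \<Rightarrow> real \<Rightarrow> real^'p \<Rightarrow> real" where
  "MM_objective \<rho> Z \<beta> s \<gamma> = km_expectation Z \<beta> (\<lambda>u x. \<rho> ((u - \<gamma> \<bullet> x) / s))"

definition is_local_min :: "('a::topological_space \<Rightarrow> real) \<Rightarrow> 'a \<Rightarrow> bool" where
  "is_local_min f x \<longleftrightarrow> (\<forall>\<^sub>F y in nhds x. f x \<le> f y)"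

text \<open>\<open>\<beta>\<close> is a possible value of the MM-estimator at \<open>Z\<close>, for some admissible choice of the initial
  S-regression estimate \<open>\<beta>\<^sub>S\<close> and of the local minimum \<open>\<gamma>\<close>.\<close>

definition is_MM_estimate ::
  "(real \<Rightarrow> real) \<Rightarrow> (real \<Rightarrow> real) \<Rightarrow> real \<Rightarrow> 'p::finite sample \<Rightarrow> real^'p \<Rightarrow> bool" where
  "is_MM_estimate \<rho>\<^sub>1 \<rho>\<^sub>2 b Z \<beta> \<longleftrightarrow>
     (\<exists>\<beta>\<^sub>S s \<gamma>.
        is_S_regression \<rho>\<^sub>1 b Z \<beta>\<^sub>S \<and>
        s = S_scale \<rho>\<^sub>1 b Z \<beta>\<^sub>S 0 \<and> s > 0 \<and>
        km_expectation Z \<beta>\<^sub>S (\<lambda>u x. \<rho>\<^sub>1 (u / s)) = b \<and>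
        is_local_min (MM_objective \<rho>\<^sub>2 Z \<beta>\<^sub>S s) \<gamma> \<and>
        MM_objective \<rho>\<^sub>2 Z \<beta>\<^sub>S s \<gamma> \<le> MM_objective \<rho>\<^sub>2 Z \<beta>\<^sub>S s 0 \<and>
        \<beta> = \<beta>\<^sub>S + \<gamma>)"

text \<open>Estimators are partial maps. An MM-estimator is an arbitrary selection of possible values,
  undefined exactly at the samples for which there is none.\<close>

type_synonym 'p estimator = "'p sample \<Rightarrow> (real^'p) option"

definition is_MM_estimator ::
  "(real \<Rightarrow> real) \<Rightarrow> (real \<Rightarrow> real) \<Rightarrow> real \<Rightarrow> 'p::finite estimator \<Rightarrow> bool" where
  "is_MM_estimator \<rho>\<^sub>1 \<rho>\<^sub>2 b T \<longleftrightarrow>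
     (\<forall>Z. case T Z of
            None \<Rightarrow> \<nexists>\<beta>. is_MM_estimate \<rho>\<^sub>1 \<rho>\<^sub>2 b Z \<beta>
          | Some \<beta> \<Rightarrow> is_MM_estimate \<rho>\<^sub>1 \<rho>\<^sub>2 b Z \<beta>)"

definition replacements :: "nat \<Rightarrow> 'p sample \<Rightarrow> 'p sample set" where
  "replacements k Z =
     {Z'. length Z' = length Z \<and>
          (\<exists>I\<subseteq>{..<length Z}. card I = k \<and> (\<forall>i\<in>{..<length Z} - I. Z' ! i = Z ! i))}"

definition breakdown_point :: "'p::finite estimator \<Rightarrow> 'p sample \<Rightarrow> ereal" where
  "breakdown_point T Z =
     Inf {ereal (real k / real (length Z)) | k.
            1 \<le> k \<and> k \<le> length Z \<and>
            (SUP Z'\<in>replacements k Z \<inter> dom T. ereal (norm (the (T Z') - the (T Z)))) = \<infinity>}"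

definition max_hyperplane_count :: "'p::finite sample \<Rightarrow> nat" where
  "max_hyperplane_count Z =
     (MAX \<theta>\<in>{\<theta>. norm \<theta> = 1}. card {i. i < length Z \<and> \<theta> \<bullet> covar Z i = 0})"

definition censored_count :: "'p sample \<Rightarrow> nat" where
  "censored_count Z = card {i. i < length Z \<and> \<not> uncensored Z i}"

end

theory Submission
  imports Defs
begin

text \<open>
  Let \<open>k < k\<^sub>0\<close> observations be replaced, and call an observation good if it is neither replaced nor
  censored; at least \<open>n - k - m\<close> are good. The proof rests on the fact that the weights
  redistribute only the censored mass: a good observation keeps mass \<open>1/n\<close> at
  \<open>(r\<^sub>i(\<beta>), x\<^sub>i)\<close> for every \<open>\<beta>\<close>, and all the others together carry mass at most
  \<open>(k + m)/n\<close>, wherever that mass has gone (\<open>km_expectation_ge\<close>, \<open>km_expectation_le\<close>).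
  At a good observation, moreover, \<open>u - \<gamma>'x\<close> is the ordinary residual of the parameter
  \<open>\<beta> + \<gamma>\<close>, so it does not matter where the initial estimate \<open>\<beta>\<^sub>S\<close> lies.

  The residual scale is bounded from above because \<open>0\<close> minimizes \<open>S(\<beta>\<^sub>S, \<cdot>)\<close>, so that
  \<open>S(\<beta>\<^sub>S, 0) \<le> S(\<beta>\<^sub>S, -\<beta>\<^sub>S)\<close>, and, with \<open>\<gamma> = -\<beta>\<^sub>S\<close>, the good residuals are
  the fixed original responses. For a large scale these contribute almost nothing, the rest contributes at most \<open>a (k + m)/n < b\<close>, and hence
  \<open>S(\<beta>\<^sub>S, -\<beta>\<^sub>S)\<close> is at most a scale \<open>s\<^sub>0\<close> that depends on the original sample only
  (\<open>S_regression_scale_le\<close>).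

  The estimate \<open>\<beta> = \<beta>\<^sub>S + \<gamma>\<close> satisfies \<open>R(\<gamma>) \<le> R(0) \<le> E[\<rho>\<^sub>1(u/s)] = b\<close>, since \<open>\<rho>\<^sub>2 \<le> \<rho>\<^sub>1\<close>.
  But compactness of the unit sphere yields \<open>c > 0\<close> such that \<open>|\<beta>'x\<^sub>i| < c \<parallel>\<beta>\<parallel>\<close> for at most \<open>q\<close>
  indices (\<open>card_near_hyperplane_le\<close>), so if \<open>\<parallel>\<beta>\<parallel>\<close> were large, at least \<open>n - k - m - q\<close> good
  residuals would be large relative to \<open>s\<^sub>0\<close>, each contributing nearly \<open>a/n\<close>, and \<open>R(\<gamma>)\<close> would
  exceed \<open>b\<close> because \<open>a (n - k - m - q) > n b\<close>. This bounds \<open>\<beta>\<close> uniformly over all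
  contaminated samples.
\<close>

section \<open>Bounded rho functions\<close>

lemma rho_function_abs_mono:
  assumes "rho_function \<rho>" and "\<bar>u\<bar> \<le> \<bar>v\<bar>"
  shows "\<rho> u \<le> \<rho> v"
proof -
  have abs_eq: "\<rho> \<bar>w\<bar> = \<rho> w" for w
    using assms(1) unfolding rho_function_def
    by (cases "w < 0") (auto simp: abs_if dest: spec[of _ "- w"])
  have "\<rho> \<bar>u\<bar> \<le> \<rho> \<bar>v\<bar>"
  proof (cases "u = 0")
    case True
    then show ?thesis using assms(1) by (simp add: rho_function_def)
  next
    case False
    with assms show ?thesis
      unfolding rho_function_def by (intro mono_onD[of "{0<..}" \<rho>]) auto
  qed
  then show ?thesis by (simp add: abs_eq)
qed

lemma rho_function_le_Sup:
  assumes "rho_function \<rho>"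
  shows "\<rho> u \<le> (SUP v. \<rho> v)"
  using assms by (auto simp: rho_function_def intro: cSUP_upper)

lemma rho_function_near_Sup:
  assumes "rho_function \<rho>" and "0 \<le> l" and "l < (SUP v. \<rho> v)"
  obtains t where "0 < t" and "\<And>u. t \<le> \<bar>u\<bar> \<Longrightarrow> l < \<rho> u"
proof -
  obtain v where v: "l < \<rho> v"
    using assms less_cSUP_iff[of UNIV \<rho> l] by (auto simp: rho_function_def)
  show thesis
  proof
    show "0 < \<bar>v\<bar>" using v assms by (auto simp: rho_function_def)
    show "l < \<rho> u" if "\<bar>v\<bar> \<le> \<bar>u\<bar>" for u
      using rho_function_abs_mono[OF assms(1) that] v by simp
  qed
qed

lemma rho_function_large_scale:
  assumes "rho_function \<rho>" and "finite I" and "0 < e"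
  obtains s where "0 < s" and "(\<Sum>i\<in>I. \<rho> (y i / s)) < e"
proof -
  have "((\<lambda>s. \<rho> (y i / s)) \<longlongrightarrow> \<rho> 0) at_top" for i
  proof (rule isCont_tendsto_compose[where g = \<rho>])
    show "isCont \<rho> 0" using assms(1) by (simp add: rho_function_def)
    show "((\<lambda>s. y i / s) \<longlongrightarrow> 0) at_top"
      by (rule tendsto_divide_0[OF tendsto_const filterlim_at_top_imp_at_infinity[OF filterlim_ident]])
  qed
  then have "((\<lambda>s. \<Sum>i\<in>I. \<rho> (y i / s)) \<longlongrightarrow> (\<Sum>i\<in>I. \<rho> 0)) at_top"
    by (rule tendsto_sum)
  then have "\<forall>\<^sub>F s in at_top. (\<Sum>i\<in>I. \<rho> (y i / s)) < e"
    using assms by (intro order_tendstoD(2)) (auto simp: rho_function_def)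
  then have "\<forall>\<^sub>F s in at_top. 0 < s \<and> (\<Sum>i\<in>I. \<rho> (y i / s)) < e"
    using eventually_gt_at_top[of "0::real"] by eventually_elim simp
  then show thesis
    using that eventually_happens'[OF trivial_limit_at_top_linorder] by blast
qed

section \<open>Points close to a hyperplane\<close>

text \<open>For every index set \<open>A\<close> with more than \<open>q\<close> elements, \<open>\<theta> \<mapsto> \<Sum>i\<in>A. |\<theta>'x\<^sub>i|\<close> is continuous and
  has no zero on the unit sphere, so it has a positive minimum there. As there are only finitely
  many such \<open>A\<close>, these minima have a common positive lower bound.\<close>

lemma card_near_hyperplane_le:
  fixes x :: "'i \<Rightarrow> 'a::euclidean_space"
  assumes "finite I"
    and q: "\<And>\<theta>. norm \<theta> = 1 \<Longrightarrow> card {i\<in>I. \<theta> \<bullet> x i = 0} \<le> q"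
  obtains c where "0 < c" and "\<And>\<theta>. card {i\<in>I. \<bar>\<theta> \<bullet> x i\<bar> < c * norm \<theta>} \<le> q"
proof -
  define \<A> where "\<A> = {A. A \<subseteq> I \<and> q < card A}"
  define f where "f A \<theta> = (\<Sum>i\<in>A. \<bar>\<theta> \<bullet> x i\<bar>)" for A and \<theta> :: 'a
  have fin: "finite \<A>" using assms(1) by (simp add: \<A>_def)
  have "\<exists>d>0. \<forall>\<theta>\<in>sphere 0 1. d \<le> f A \<theta>" if "A \<in> \<A>" for A
  proof -
    from that have A: "A \<subseteq> I" "q < card A" by (auto simp: \<A>_def)
    have finA: "finite A" using A assms(1) finite_subset by blast
    have "continuous_on (sphere 0 1) (f A)"
      unfolding f_def by (intro continuous_intros)
    then obtain \<theta>\<^sub>0 where \<theta>\<^sub>0: "\<theta>\<^sub>0 \<in> sphere 0 1" "\<forall>\<theta>\<in>sphere 0 1. f A \<theta>\<^sub>0 \<le> f A \<theta>"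
      using continuous_attains_inf[of "sphere 0 1 :: 'a set" "f A"] by auto
    have "f A \<theta>\<^sub>0 \<noteq> 0"
    proof
      assume "f A \<theta>\<^sub>0 = 0"
      then have "A \<subseteq> {i\<in>I. \<theta>\<^sub>0 \<bullet> x i = 0}"
        using finA A by (auto simp: f_def sum_nonneg_eq_0_iff)
      then have "card A \<le> card {i\<in>I. \<theta>\<^sub>0 \<bullet> x i = 0}"
        using assms(1) by (intro card_mono) auto
      with q[of \<theta>\<^sub>0] \<theta>\<^sub>0 A show False by simp
    qed
    moreover have "0 \<le> f A \<theta>\<^sub>0" by (simp add: f_def sum_nonneg)
    ultimately show ?thesis using \<theta>\<^sub>0 by (intro exI[of _ "f A \<theta>\<^sub>0"]) auto
  qed
  then obtain d where d: "\<And>A. A \<in> \<A> \<Longrightarrow> 0 < d A"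
    "\<And>A \<theta>. A \<in> \<A> \<Longrightarrow> \<theta> \<in> sphere 0 1 \<Longrightarrow> d A \<le> f A \<theta>"
    by metis
  define e where "e = Min (insert 1 (d ` \<A>))"
  have e: "0 < e" "\<And>A. A \<in> \<A> \<Longrightarrow> e \<le> d A"
    using d(1) fin by (auto simp: e_def Min_le_iff)
  \<comment> \<open>A sum of at most \<open>card I\<close> terms that are all below \<open>c\<close> stays below \<open>e\<close>; adding 1 keeps the
    denominator positive when \<open>I\<close> is empty.\<close>
  define c where "c = e / (real (card I) + 1)"
  have c: "0 < c" using e by (simp add: c_def)
  have unit: "card {i\<in>I. \<bar>\<theta> \<bullet> x i\<bar> < c} \<le> q" if "norm \<theta> = 1" for \<theta>
  proof (rule ccontr)
    define A where "A = {i\<in>I. \<bar>\<theta> \<bullet> x i\<bar> < c}"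
    assume "\<not> ?thesis"
    then have A: "A \<in> \<A>" by (auto simp: A_def \<A>_def)
    have "e \<le> f A \<theta>" using e(2)[OF A] d(2)[OF A, of \<theta>] that by simp
    also have "\<dots> \<le> real (card A) * c"
      unfolding f_def by (intro sum_bounded_above) (auto simp: A_def)
    also have "\<dots> \<le> real (card I) * c"
      using c assms(1) by (auto simp: A_def intro!: mult_right_mono card_mono)
    also have "\<dots> < (real (card I) + 1) * c" using c by simp
    also have "\<dots> = e" by (simp add: c_def)
    finally show False by simp
  qed
  have "card {i\<in>I. \<bar>\<theta> \<bullet> x i\<bar> < c * norm \<theta>} \<le> q" for \<theta>
  proof (cases "\<theta> = 0")
    case False
    then have "{i\<in>I. \<bar>\<theta> \<bullet> x i\<bar> < c * norm \<theta>} = {i\<in>I. \<bar>sgn \<theta> \<bullet> x i\<bar> < c}"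
      by (auto simp: sgn_div_norm abs_mult field_simps)
    with unit[of "sgn \<theta>"] False show ?thesis by (simp add: norm_sgn)
  qed simp
  with c that show thesis by blast
qed

section \<open>Kaplan--Meier weights\<close>

lemma finite_km_values: "finite (km_values Z \<beta>)"
  by (simp add: km_values_def)

lemma km_survival_factor_bounds:
  "0 \<le> 1 - real (km_deaths Z \<beta> v) / real (km_at_risk Z \<beta> v)"
  "1 - real (km_deaths Z \<beta> v) / real (km_at_risk Z \<beta> v) \<le> 1"
proof -
  have "km_deaths Z \<beta> v \<le> km_at_risk Z \<beta> v"
    unfolding km_deaths_def km_at_risk_def by (intro card_mono) auto
  then show "0 \<le> 1 - real (km_deaths Z \<beta> v) / real (km_at_risk Z \<beta> v)"
    by (cases "km_at_risk Z \<beta> v = 0") auto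
  show "1 - real (km_deaths Z \<beta> v) / real (km_at_risk Z \<beta> v) \<le> 1" by simp
qed

text \<open>The product-limit estimator is a step function, so just to the left of \<open>t\<close> it is constant.\<close>

lemma km_cdf_left_limit:
  "(km_cdf Z \<beta> \<longlongrightarrow>
     1 - (\<Prod>v\<in>{v \<in> km_values Z \<beta>. v < t}. 1 - real (km_deaths Z \<beta> v) / real (km_at_risk Z \<beta> v)))
   (at_left t)"
proof (rule tendsto_eventually)
  have "\<forall>\<^sub>F s in at_left t. v \<le> s \<longleftrightarrow> v < t" for v :: real
  proof (cases "v < t")
    case True
    then have "\<forall>\<^sub>F s in at_left t. s \<in> {v<..<t}" by (rule eventually_at_left_real)
    then show ?thesis by eventually_elim (use True in auto)
  next
    case False
    then show ?thesis by (auto simp: eventually_at_filter)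
  qed
  then have "\<forall>\<^sub>F s in at_left t. \<forall>v\<in>km_values Z \<beta>. v \<le> s \<longleftrightarrow> v < t"
    by (intro eventually_ball_finite finite_km_values) auto
  then show "\<forall>\<^sub>F s in at_left t. km_cdf Z \<beta> s =
      1 - (\<Prod>v\<in>{v \<in> km_values Z \<beta>. v < t}. 1 - real (km_deaths Z \<beta> v) / real (km_at_risk Z \<beta> v))"
  proof eventually_elim
    case (elim s)
    then have "{v \<in> km_values Z \<beta>. v \<le> s} = {v \<in> km_values Z \<beta>. v < t}" by auto
    then show ?case by (simp add: km_cdf_def)
  qed
qed

lemma km_jump_nonneg: "0 \<le> jump (km_cdf Z \<beta>) t"
proof -
  let ?f = "\<lambda>v. 1 - real (km_deaths Z \<beta> v) / real (km_at_risk Z \<beta> v)"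
  let ?A = "{v \<in> km_values Z \<beta>. v < t}" and ?B = "{v \<in> km_values Z \<beta>. v \<le> t}"
  have "prod ?f ?B = prod ?f (?B - ?A) * prod ?f ?A"
    by (rule prod.subset_diff) (auto simp: finite_km_values)
  also have "\<dots> \<le> 1 * prod ?f ?A"
    by (intro mult_right_mono prod_le_1 prod_nonneg) (use km_survival_factor_bounds in auto)
  finally have "prod ?f ?B \<le> prod ?f ?A" by simp
  moreover have "Lim (at_left t) (km_cdf Z \<beta>) = 1 - prod ?f ?A"
    by (intro tendsto_Lim km_cdf_left_limit) simp
  ultimately show ?thesis by (simp add: jump_def km_cdf_def)
qed

lemma km_mass_nonneg: "0 \<le> km_mass Z \<beta> j"
  by (simp add: km_mass_def km_jump_nonneg)

lemma km_weight_nonneg: "0 \<le> km_weight Z \<beta> i j"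
  by (simp add: km_weight_def km_mass_nonneg sum_nonneg)

text \<open>In a censored row the normalising sum cancels; if it vanished, division by zero would give the
  row mass zero, and the inequality would hold as well.\<close>

lemma km_weight_row_le: "(\<Sum>j<length Z. km_weight Z \<beta> i j) \<le> 1 / real (length Z)"
proof (cases "km_uncensored Z \<beta> i")
  case True
  then have "(\<Sum>j<length Z. km_weight Z \<beta> i j)
      = (\<Sum>j<length Z. if i = j then 1 / real (length Z) else 0)"
    by (intro sum.cong) (auto simp: km_weight_def)
  then show ?thesis by simp
next
  case False
  let ?L = "later_uncensored Z \<beta> i"
  let ?S = "\<Sum>k\<in>?L. km_mass Z \<beta> k"
  have "(\<Sum>j<length Z. km_weight Z \<beta> i j) = (\<Sum>j\<in>?L. km_weight Z \<beta> i j)"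
    by (rule sum.mono_neutral_right) (use False in \<open>auto simp: km_weight_def later_uncensored_def\<close>)
  also have "\<dots> = ?S / (real (length Z) * ?S)"
    using False by (simp add: km_weight_def sum_divide_distrib)
  also have "\<dots> \<le> 1 / real (length Z)" by simp
  finally show ?thesis .
qed

text \<open>Treating the largest residuals as uncensored only ever adds uncensored observations, so the row
  of one that is uncensored from the start consists of its diagonal entry for every \<open>\<beta>\<close>.\<close>

lemma km_weight_row_uncensored:
  assumes "i < length Z" and "uncensored Z i"
  shows "(\<Sum>j<length Z. km_weight Z \<beta> i j * h j) = h i / real (length Z)"
proof -
  have "(\<Sum>j<length Z. km_weight Z \<beta> i j * h j)
      = (\<Sum>j<length Z. if i = j then h i / real (length Z) else 0)"
    using assms(2) by (intro sum.cong) (auto simp: km_weight_def km_uncensored_def)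
  then show ?thesis using assms(1) by simp
qed

lemma km_expectation_mono:
  assumes "\<And>u x. g u x \<le> h u x"
  shows "km_expectation Z \<beta> g \<le> km_expectation Z \<beta> h"
  unfolding km_expectation_def
  by (intro sum_mono mult_left_mono km_weight_nonneg assms)

text \<open>Splitting off uncensored observations \<open>G\<close> leaves rows of mass at most \<open>1/n\<close> each. The two
  bounds that follow hold no matter how the censored observations distribute their mass.\<close>

lemma km_expectation_split:
  assumes "G \<subseteq> {i. i < length Z \<and> uncensored Z i}"
  shows "km_expectation Z \<beta> g =
    (\<Sum>i\<in>G. g (resid Z \<beta> i) (covar Z i)) / real (length Z) +
    (\<Sum>i\<in>{..<length Z} - G. \<Sum>j<length Z. km_weight Z \<beta> i j * g (resid Z \<beta> j) (covar Z i))"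
proof -
  let ?r = "\<lambda>i. \<Sum>j<length Z. km_weight Z \<beta> i j * g (resid Z \<beta> j) (covar Z i)"
  have "km_expectation Z \<beta> g = sum ?r ({..<length Z} - G) + sum ?r G"
    unfolding km_expectation_def using assms by (intro sum.subset_diff) auto
  also have "sum ?r G = (\<Sum>i\<in>G. g (resid Z \<beta> i) (covar Z i) / real (length Z))"
    using assms by (intro sum.cong refl km_weight_row_uncensored) auto
  finally show ?thesis by (simp add: sum_divide_distrib)
qed

lemma km_expectation_ge:
  assumes "G \<subseteq> {i. i < length Z \<and> uncensored Z i}" and "\<And>u x. 0 \<le> g u x"
  shows "(\<Sum>i\<in>G. g (resid Z \<beta> i) (covar Z i)) / real (length Z) \<le> km_expectation Z \<beta> g"
  unfolding km_expectation_split[OF assms(1)]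
  using assms(2) by (simp add: sum_nonneg km_weight_nonneg)

lemma km_expectation_le:
  assumes "G \<subseteq> {i. i < length Z \<and> uncensored Z i}"
    and "0 \<le> B" and "\<And>u x. g u x \<le> B"
  shows "km_expectation Z \<beta> g \<le>
    ((\<Sum>i\<in>G. g (resid Z \<beta> i) (covar Z i)) + B * (real (length Z) - real (card G)))
      / real (length Z)"
proof -
  have G: "G \<subseteq> {..<length Z}" using assms(1) by auto
  then have "finite G" using finite_subset by blast
  have row: "(\<Sum>j<length Z. km_weight Z \<beta> i j * g (resid Z \<beta> j) (covar Z i))
      \<le> B / real (length Z)" for i
  proof -
    have "(\<Sum>j<length Z. km_weight Z \<beta> i j * g (resid Z \<beta> j) (covar Z i))
        \<le> (\<Sum>j<length Z. km_weight Z \<beta> i j) * B"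
      unfolding sum_distrib_right
      by (intro sum_mono mult_left_mono assms(3) km_weight_nonneg)
    also have "\<dots> \<le> 1 / real (length Z) * B"
      by (intro mult_right_mono km_weight_row_le assms(2))
    finally show ?thesis by simp
  qed
  have "(\<Sum>i\<in>{..<length Z} - G. \<Sum>j<length Z. km_weight Z \<beta> i j * g (resid Z \<beta> j) (covar Z i))
      \<le> real (card ({..<length Z} - G)) * (B / real (length Z))"
    by (intro sum_bounded_above row)
  moreover have "real (card ({..<length Z} - G)) = real (length Z) - real (card G)"
    using G \<open>finite G\<close> card_mono[OF _ G] by (simp add: card_Diff_subset of_nat_diff)
  ultimately show ?thesis
    unfolding km_expectation_split[OF assms(1)] by (simp add: add_divide_distrib mult.commute)
qed

section \<open>Consequences of the defining properties of the estimators\<close>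

text \<open>\<open>\<gamma> = -\<beta>\<close> competes with the minimizer \<open>0\<close>, and its residuals \<open>r\<^sub>i(\<beta>) + \<beta>'x\<^sub>i\<close> at the uncensored
  observations are the responses themselves. The resulting bound thus involves neither \<open>\<beta>\<close> nor the
  observations outside \<open>G\<close>.\<close>

lemma S_regression_scale_le:
  assumes "rho_function \<rho>" and "0 \<le> B" and "\<And>u. \<rho> u \<le> B"
    and "is_S_regression \<rho> b Z \<beta>"
    and G: "G \<subseteq> {i. i < length Z \<and> uncensored Z i}"
    and "0 < s" and "0 < length Z"
    and small: "(\<Sum>i\<in>G. \<rho> (resp Z i / s)) + B * (real (length Z) - real (card G))
      < real (length Z) * b"
  shows "S_scale \<rho> b Z \<beta> 0 \<le> s"
proof -
  have "km_expectation Z \<beta> (\<lambda>u x. \<rho> ((u - (- \<beta>) \<bullet> x) / s))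
      \<le> ((\<Sum>i\<in>G. \<rho> ((resid Z \<beta> i - (- \<beta>) \<bullet> covar Z i) / s))
          + B * (real (length Z) - real (card G))) / real (length Z)"
    by (intro km_expectation_le G assms)
  also have "\<dots> < b" using small assms(7) by (simp add: resid_def field_simps)
  finally have "S_scale \<rho> b Z \<beta> (- \<beta>) \<le> s"
    unfolding S_scale_def using assms(6)
    by (intro cInf_lower bdd_belowI[of _ 0]) auto
  moreover have "S_scale \<rho> b Z \<beta> 0 \<le> S_scale \<rho> b Z \<beta> (- \<beta>)"
    using assms(4) by (simp add: is_S_regression_def is_gamma_hat_def is_arg_min_linorder)
  ultimately show ?thesis by simp
qed

text \<open>At uncensored observations the residuals of \<open>\<gamma>\<close> with respect to \<open>\<beta>\<^sub>S\<close> are those of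
  \<open>\<beta> = \<beta>\<^sub>S + \<gamma>\<close>. The bound \<open>b\<close> on the objective at \<open>\<gamma>\<close>, inherited from the equation that defines
  the scale, therefore constrains the final estimate directly.\<close>

lemma MM_estimate_uncensored_residuals:
  assumes "rho_function \<rho>\<^sub>1" and "rho_function \<rho>\<^sub>2" and "\<And>u. \<rho>\<^sub>2 u \<le> \<rho>\<^sub>1 u"
    and "0 \<le> B" and "\<And>u. \<rho>\<^sub>1 u \<le> B"
    and "is_MM_estimate \<rho>\<^sub>1 \<rho>\<^sub>2 b Z \<beta>"
    and G: "G \<subseteq> {i. i < length Z \<and> uncensored Z i}"
    and "0 < s\<^sub>0" and "0 < length Z"
    and "(\<Sum>i\<in>G. \<rho>\<^sub>1 (resp Z i / s\<^sub>0)) + B * (real (length Z) - real (card G))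
      < real (length Z) * b"
  obtains s where "0 < s" and "s \<le> s\<^sub>0"
    and "(\<Sum>i\<in>G. \<rho>\<^sub>2 (resid Z \<beta> i / s)) \<le> real (length Z) * b"
proof -
  from assms(6) obtain \<beta>\<^sub>S s \<gamma> where
    init: "is_S_regression \<rho>\<^sub>1 b Z \<beta>\<^sub>S" "s = S_scale \<rho>\<^sub>1 b Z \<beta>\<^sub>S 0" "0 < s"
      "km_expectation Z \<beta>\<^sub>S (\<lambda>u x. \<rho>\<^sub>1 (u / s)) = b"
    and \<gamma>: "MM_objective \<rho>\<^sub>2 Z \<beta>\<^sub>S s \<gamma> \<le> MM_objective \<rho>\<^sub>2 Z \<beta>\<^sub>S s 0" "\<beta> = \<beta>\<^sub>S + \<gamma>"
    unfolding is_MM_estimate_def by blast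
  have "(\<Sum>i\<in>G. \<rho>\<^sub>2 (resid Z \<beta> i / s)) / real (length Z)
      = (\<Sum>i\<in>G. \<rho>\<^sub>2 ((resid Z \<beta>\<^sub>S i - \<gamma> \<bullet> covar Z i) / s)) / real (length Z)"
    by (simp add: \<gamma>(2) resid_def inner_add_left algebra_simps)
  also have "\<dots> \<le> MM_objective \<rho>\<^sub>2 Z \<beta>\<^sub>S s \<gamma>"
    unfolding MM_objective_def
    by (rule km_expectation_ge[OF G]) (use assms(2) in \<open>simp add: rho_function_def\<close>)
  also have "\<dots> \<le> MM_objective \<rho>\<^sub>2 Z \<beta>\<^sub>S s 0" by (rule \<gamma>)
  also have "\<dots> \<le> km_expectation Z \<beta>\<^sub>S (\<lambda>u x. \<rho>\<^sub>1 (u / s))"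
    unfolding MM_objective_def by (intro km_expectation_mono) (simp add: assms(3))
  also have "\<dots> = b" by (rule init)
  finally have "(\<Sum>i\<in>G. \<rho>\<^sub>2 (resid Z \<beta> i / s)) \<le> real (length Z) * b"
    using assms(9) by (simp add: divide_le_eq mult.commute)
  moreover have "s \<le> s\<^sub>0"
    unfolding init(2) by (rule S_regression_scale_le[OF assms(1,4,5) init(1) assms(7-10)])
  ultimately show thesis using that init(3) by blast
qed

section \<open>The breakdown point\<close>

lemma card_hyperplane_le_max_hyperplane_count:
  assumes "norm \<theta> = 1"
  shows "card {i. i < length Z \<and> \<theta> \<bullet> covar Z i = 0} \<le> max_hyperplane_count Z"
  unfolding max_hyperplane_count_def
proof (rule Max_ge)
  let ?c = "\<lambda>\<theta>. card {i. i < length Z \<and> \<theta> \<bullet> covar Z i = 0}"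
  have "?c \<theta> \<le> length Z" for \<theta>
    using card_mono[of "{..<length Z}" "{i. i < length Z \<and> \<theta> \<bullet> covar Z i = 0}"] by auto
  then have "?c ` {\<theta>. norm \<theta> = 1} \<subseteq> {..length Z}" by auto
  then show "finite (?c ` {\<theta>. norm \<theta> = 1})" using finite_subset by blast
qed (use assms in auto)

lemma replacements_good_observations:
  assumes "Z' \<in> replacements k Z"
  obtains G where "G \<subseteq> {i. i < length Z' \<and> uncensored Z' i}"
    and "\<And>i. i \<in> G \<Longrightarrow> Z' ! i = Z ! i"
    and "length Z \<le> card G + k + censored_count Z"
proof -
  from assms obtain I where I: "length Z' = length Z" "I \<subseteq> {..<length Z}" "card I = k"
    "\<And>i. i \<in> {..<length Z} - I \<Longrightarrow> Z' ! i = Z ! i"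
    by (auto simp: replacements_def)
  define C where "C = {i. i < length Z \<and> \<not> uncensored Z i}"
  define G where "G = {..<length Z} - I - C"
  have "length Z = card {..<length Z}" by simp
  also have "\<dots> \<le> card (G \<union> I \<union> C)"
    using I(2) by (intro card_mono) (auto simp: G_def C_def intro: finite_subset)
  also have "\<dots> \<le> card G + card I + card C"
    by (meson add_right_mono card_Un_le order_trans)
  finally have "length Z \<le> card G + k + censored_count Z"
    by (simp add: I(3) C_def censored_count_def)
  moreover have "G \<subseteq> {i. i < length Z' \<and> uncensored Z' i}"
    using I(1,4) by (auto simp: G_def C_def uncensored_def)
  moreover have "Z' ! i = Z ! i" if "i \<in> G" for i
    using that I(4) by (auto simp: G_def)
  ultimately show thesis using that by blast
qed

text \<open>The hypotheses say \<open>k < k\<^sub>0\<close>: the first keeps the scale bounded, the second makes large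
  estimates too expensive.\<close>

lemma MM_estimate_bounded_on_replacements:
  fixes Z :: "'p::finite sample"
  assumes rho: "rho_function \<rho>\<^sub>1" "rho_function \<rho>\<^sub>2" "\<And>u. \<rho>\<^sub>2 u \<le> \<rho>\<^sub>1 u"
    and Sup: "(SUP u. \<rho>\<^sub>1 u) = a" "(SUP u. \<rho>\<^sub>2 u) = a" and "0 < a" and "0 < b"
    and n: "length Z = n" "0 < n"
    and scale: "a * (real k + real (censored_count Z)) < real n * b"
    and loss: "real n * b
      < a * (real n - real k - real (censored_count Z) - real (max_hyperplane_count Z))"
  obtains M where
    "\<And>Z' \<beta>. Z' \<in> replacements k Z \<Longrightarrow> is_MM_estimate \<rho>\<^sub>1 \<rho>\<^sub>2 b Z' \<beta> \<Longrightarrow> norm \<beta> \<le> M"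
proof -
  define m q where "m = censored_count Z" and "q = max_hyperplane_count Z"
  define N where "N = real n - real k - real m - real q"
  have \<rho>\<^sub>1_nonneg: "0 \<le> \<rho>\<^sub>1 u" and \<rho>\<^sub>2_nonneg: "0 \<le> \<rho>\<^sub>2 u" for u
    using rho by (auto simp: rho_function_def)
  have \<rho>\<^sub>1_le: "\<rho>\<^sub>1 u \<le> a" for u using rho_function_le_Sup[OF rho(1)] Sup(1) by simp
  obtain s\<^sub>0 where s\<^sub>0: "0 < s\<^sub>0"
    "(\<Sum>i<n. \<rho>\<^sub>1 (resp Z i / s\<^sub>0)) < real n * b - a * (real k + real m)"
    using rho_function_large_scale[OF rho(1), of "{..<n}"] scale
    unfolding m_def by (metis diff_gt_0_iff_gt finite_lessThan)
  have "0 < real n * b" using \<open>0 < b\<close> n by simp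
  then have "0 < a * N" using loss unfolding N_def m_def q_def by linarith
  then have N: "0 < N" using \<open>0 < a\<close> by (simp add: zero_less_mult_iff)
  have "real n * b / N < a" using loss N by (simp add: divide_less_eq N_def m_def q_def)
  \<comment> \<open>Any \<open>N\<close> standardized residuals of size at least \<open>t\<close> already push the objective above \<open>b\<close>.\<close>
  then obtain t where t: "0 < t" "\<And>u. t \<le> \<bar>u\<bar> \<Longrightarrow> real n * b / N < \<rho>\<^sub>2 u"
    using rho_function_near_Sup[OF rho(2), of "real n * b / N"] N \<open>0 < b\<close> Sup(2) by auto
  obtain c where c: "0 < c"
    "\<And>\<theta>. card {i\<in>{..<n}. \<bar>\<theta> \<bullet> covar Z i\<bar> < c * norm \<theta>} \<le> q"
    using card_near_hyperplane_le[of "{..<n}" "covar Z" q]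
      card_hyperplane_le_max_hyperplane_count[of _ Z] n
    unfolding q_def by auto
  define Y where "Y = (\<Sum>i<n. \<bar>resp Z i\<bar>)"
  have Y: "\<bar>resp Z i\<bar> \<le> Y" if "i < n" for i
    unfolding Y_def using that by (intro member_le_sum) auto
  have "norm \<beta> \<le> (t * s\<^sub>0 + Y) / c"
    if Z': "Z' \<in> replacements k Z" and \<beta>: "is_MM_estimate \<rho>\<^sub>1 \<rho>\<^sub>2 b Z' \<beta>" for Z' \<beta>
  proof (rule ccontr)
    assume "\<not> ?thesis"
    then have large: "t * s\<^sub>0 + Y < c * norm \<beta>"
      using c(1) by (simp add: divide_less_eq mult.commute not_le)
    have len: "length Z' = n" using Z' n by (simp add: replacements_def)
    obtain G where G: "G \<subseteq> {i. i < length Z' \<and> uncensored Z' i}"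
      "\<And>i. i \<in> G \<Longrightarrow> Z' ! i = Z ! i" "n \<le> card G + k + m"
      using replacements_good_observations[OF Z'] n unfolding m_def by metis
    have G_sub: "G \<subseteq> {..<n}" using G(1) len by auto
    then have finG: "finite G" using finite_subset by blast
    have "(\<Sum>i\<in>G. \<rho>\<^sub>1 (resp Z' i / s\<^sub>0)) = (\<Sum>i\<in>G. \<rho>\<^sub>1 (resp Z i / s\<^sub>0))"
      using G(2) by (simp add: resp_def)
    also have "\<dots> \<le> (\<Sum>i<n. \<rho>\<^sub>1 (resp Z i / s\<^sub>0))"
      using G_sub \<rho>\<^sub>1_nonneg by (intro sum_mono2) auto
    finally have "(\<Sum>i\<in>G. \<rho>\<^sub>1 (resp Z' i / s\<^sub>0)) < real n * b - a * (real k + real m)"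
      using s\<^sub>0(2) by simp
    moreover have "a * (real n - real (card G)) \<le> a * (real k + real m)"
      using G(3) \<open>0 < a\<close> by (intro mult_left_mono) auto
    ultimately have small: "(\<Sum>i\<in>G. \<rho>\<^sub>1 (resp Z' i / s\<^sub>0))
        + a * (real (length Z') - real (card G)) < real (length Z') * b"
      using len by simp
    obtain s where s: "0 < s" "s \<le> s\<^sub>0" "(\<Sum>i\<in>G. \<rho>\<^sub>2 (resid Z' \<beta> i / s)) \<le> real n * b"
      using MM_estimate_uncensored_residuals[OF rho less_imp_le[OF \<open>0 < a\<close>] \<rho>\<^sub>1_le \<beta> G(1) s\<^sub>0(1) _ small]
        len n by auto
    define F where "F = {i\<in>{..<n}. \<bar>\<beta> \<bullet> covar Z i\<bar> < c * norm \<beta>}"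
    have far: "real n * b / N < \<rho>\<^sub>2 (resid Z' \<beta> i / s)" if "i \<in> G - F" for i
    proof (rule t(2))
      have i: "i < n" using that G_sub by auto
      have "c * norm \<beta> \<le> \<bar>\<beta> \<bullet> covar Z i\<bar>" using that i by (auto simp: F_def)
      then have "t * s\<^sub>0 \<le> \<bar>resp Z i - \<beta> \<bullet> covar Z i\<bar>" using large Y[OF i] by linarith
      moreover have "t * s \<le> t * s\<^sub>0" using t(1) s(2) by simp
      ultimately have "t * s \<le> \<bar>resid Z' \<beta> i\<bar>"
        using G(2)[of i] that by (simp add: resid_def resp_def covar_def)
      then show "t \<le> \<bar>resid Z' \<beta> i / s\<bar>" using s(1) by (simp add: le_divide_eq)
    qed
    have "card G - card F \<le> card (G - F)"
      by (rule diff_card_le_card_Diff) (simp add: F_def)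
    moreover have "card F \<le> q" using c(2)[of \<beta>] by (simp add: F_def)
    ultimately have N_le: "N \<le> real (card (G - F))" using G(3) by (simp add: N_def)
    have nonempty: "G - F \<noteq> {}"
    proof
      assume "G - F = {}"
      with N N_le show False by (simp only: card.empty of_nat_0)
    qed
    have "real n * b = N * (real n * b / N)" using N by simp
    also have "\<dots> \<le> real (card (G - F)) * (real n * b / N)"
      using N_le N \<open>0 < b\<close> by (intro mult_right_mono) auto
    also have "\<dots> = (\<Sum>i\<in>G - F. real n * b / N)" by simp
    also have "\<dots> < (\<Sum>i\<in>G - F. \<rho>\<^sub>2 (resid Z' \<beta> i / s))"
      using finG nonempty far by (intro sum_strict_mono) auto
    also have "\<dots> \<le> (\<Sum>i\<in>G. \<rho>\<^sub>2 (resid Z' \<beta> i / s))"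
      using finG \<rho>\<^sub>2_nonneg by (intro sum_mono2) auto
    finally show False using s(3) by simp
  qed
  then show thesis by (rule that)
qed

theorem theorem3:
  fixes \<rho>\<^sub>1 \<rho>\<^sub>2 :: "real \<Rightarrow> real" and a b k\<^sub>0 :: real and n q m :: nat
    and Z :: "'p::finite sample" and T :: "'p estimator"
  assumes "rho_function \<rho>\<^sub>1" and "rho_function \<rho>\<^sub>2"
    and "\<And>u. \<rho>\<^sub>2 u \<le> \<rho>\<^sub>1 u"
    and "(SUP u. \<rho>\<^sub>1 u) = a" and "(SUP u. \<rho>\<^sub>2 u) = a" and "a > 0"
    and "0 < b" and "b < a"
    and "length Z = n"
    and "dim (covar Z ` {..<n}) = CARD('p)"
    and "q = max_hyperplane_count Z" and "m = censored_count Z"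
    and "k\<^sub>0 = min (real n * (1 - b / a) - real q - real m) (real n * (b / a) - real m)"
    and "is_MM_estimator \<rho>\<^sub>1 \<rho>\<^sub>2 b T"
    and "Z \<in> dom T"
  shows "breakdown_point T Z \<ge> ereal (k\<^sub>0 / real n)"
  unfolding breakdown_point_def
proof (rule Inf_greatest, clarify)
  fix k assume k: "1 \<le> k" "k \<le> length Z"
    and breakdown:
      "(SUP Z'\<in>replacements k Z \<inter> dom T. ereal (norm (the (T Z') - the (T Z)))) = \<infinity>"
  have n: "0 < n" using k assms(9) by simp
  have "k\<^sub>0 \<le> real k"
  proof (rule ccontr)
    assume "\<not> k\<^sub>0 \<le> real k"
    then have "real k < real n * (1 - b / a) - real q - real m" "real k < real n * (b / a) - real m"
      using assms(13) by auto
    then have "a * (real k + real m) < real n * b" "real n * b < a * (real n - real k - real m - real q)"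
      using \<open>a > 0\<close> by (auto simp: field_simps)
    then obtain M where M:
      "\<And>Z' \<beta>. Z' \<in> replacements k Z \<Longrightarrow> is_MM_estimate \<rho>\<^sub>1 \<rho>\<^sub>2 b Z' \<beta> \<Longrightarrow> norm \<beta> \<le> M"
      using MM_estimate_bounded_on_replacements[OF assms(1-7,9) n, of k] assms(11,12) by metis
    have "(SUP Z'\<in>replacements k Z \<inter> dom T. ereal (norm (the (T Z') - the (T Z))))
        \<le> ereal (M + norm (the (T Z)))"
    proof (rule SUP_least)
      fix Z' assume Z': "Z' \<in> replacements k Z \<inter> dom T"
      then obtain \<beta> where \<beta>: "T Z' = Some \<beta>" by auto
      have "is_MM_estimate \<rho>\<^sub>1 \<rho>\<^sub>2 b Z' \<beta>"
        using assms(14) \<beta> unfolding is_MM_estimator_def by (auto dest: spec[of _ Z'])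
      then have "norm \<beta> \<le> M" using M Z' by blast
      then show "ereal (norm (the (T Z') - the (T Z))) \<le> ereal (M + norm (the (T Z)))"
        using norm_triangle_ineq4[of \<beta> "the (T Z)"] \<beta> by simp
    qed
    with breakdown show False by simp
  qed
  then show "ereal (k\<^sub>0 / real n) \<le> ereal (real k / real (length Z))"
    using n assms(9) by (simp add: divide_right_mono)
qed

end
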